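(* Let $N_1,N_2$ be positive integers and let $0\le k<N_1$ and $0\le l<N_2$. Then the following hold. (1) For any $N_1\times N_2$ integer matrix $X$, there exists an $N_1\times N_2$ integer matrix $Y$ such that, for every frequency $(k',l')$, $\tilde X_{k'l'}\ne\tilde Y_{k'l'}$ if and only if $(k',l')\sim(k,l)$. (2) There exist $N_1\times N_2$ binary matrices $X^{(1)}$ and $X^{(2)}$ (all entries in $\{0,1\}$) such that, for every frequency $(k',l')$, $\tilde X^{(1)}_{k'l'}\ne\tilde X^{(2)}_{k'l'}$ if and only if $(k',l')\sim(k,l)$.
   Context: Matrix entries $X_{mn}$ are indexed by $0\le m<N_1$, $0\le n<N_2$. The two-dimensional DFT of an $N_1\times N_2$ matrix $X$ is $\tilde X_{kl}=\sum_{m=0}^{N_1-1}\sum_{n=0}^{N_2-1}X_{mn}\,e^{-2\pi i\left(\frac{mk}{N_1}+\frac{nl}{N_2}\right)}$ for integers $k,l$; it is periodic with period $N_1$ in $k$ and $N_2$ in $l$. A frequency is a pair of integers (taken modulo $N_1$ and $N_2$ respectively). For a frequency $(k,l)$ put $D_1=N_1/\gcd(k,N_1)$, $D_2=N_2/\gcd(l,N_2)$, $D=\operatorname{lcm}(D_1,D_2)$ (with $\gcd(0,N)=N$). Two frequencies are equivalent, written $(k,l)\sim(k',l')$, if there exists a nonzero integer $\lambda$ relatively prime to $D$ such that $k'\equiv\lambda k\pmod{N_1}$ and $l'\equiv\lambda l\pmod{N_2}$. This is an equivalence relation on frequencies. *)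

theory Defs
  imports Complex_Main "HOL-Number_Theory.Cong" "Jordan_Normal_Form.Matrix"
begin

definition dft2 :: "complex mat \<Rightarrow> int \<times> int \<Rightarrow> complex" where
  "dft2 X = (\<lambda>(k, l). \<Sum>m<dim_row X. \<Sum>n<dim_col X. X $$ (m, n) *
     exp (- 2 * complex_of_real pi * \<i> *
       (of_nat m * of_int k / of_nat (dim_row X) + of_nat n * of_int l / of_nat (dim_col X))))"

definition freq_order :: "nat \<Rightarrow> nat \<Rightarrow> int \<times> int \<Rightarrow> int" where
  "freq_order N1 N2 = (\<lambda>(k, l). lcm (int N1 div gcd k (int N1)) (int N2 div gcd l (int N2)))"

text \<open>Frequencies are represented by arbitrary integer pairs, read modulo the matrix dimensions.
  The multiplier is required to be coprime to the order of the first frequency.\<close>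

definition freq_equiv :: "nat \<Rightarrow> nat \<Rightarrow> int \<times> int \<Rightarrow> int \<times> int \<Rightarrow> bool" where
  "freq_equiv N1 N2 = (\<lambda>(k, l) (k', l').
     \<exists>c::int. c \<noteq> 0 \<and> coprime c (freq_order N1 N2 (k, l)) \<and>
       [k' = c * k] (mod int N1) \<and> [l' = c * l] (mod int N2))"

end

theory Submission
  imports Defs "HOL-Library.Real_Mod"
begin

text \<open>
  Both parts reduce to one construction: a \<open>{-1,0,1}\<close>-valued \<open>Z\<close> on the grid whose transform is
  non-zero exactly on the class of \<open>(k, l)\<close>. Then \<open>X + Z\<close> serves as \<open>Y\<close> in (1), and the positive
  and negative parts of \<open>Z\<close> are the two binary matrices of (2).

  Let \<open>D\<close> be the order of \<open>(k, l)\<close>. The character \<open>(m, n) \<mapsto> mk/N1 + nl/N2\<close> modulo 1 takes its values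
  in the multiples of \<open>1/D\<close>; write it as \<open>(mu + nv)/D\<close>. The integers \<open>u, v, D\<close> have no common factor,
  so \<open>phase m n = mu + nv\<close> maps the grid onto \<open>\<int>/D\<close>. Look for \<open>Z = f \<circ> phase\<close> with
  \<open>f\<close> of period \<open>D\<close>. The transform of such a \<open>Z\<close> vanishes at every frequency whose character is
  non-trivial on the kernel of \<open>phase\<close>, and the other frequencies are the multiples \<open>c(k, l)\<close>
  (\<open>exists_multiplier\<close>). At \<open>c(k, l)\<close> the transform is a positive number times
  \<open>F(\<zeta>\<^sup>c)\<close>, where \<open>F\<close> is the generating polynomial of \<open>f\<close> and \<open>\<zeta>\<close> is a primitive \<open>D\<close>-th root of
  unity.

  Take \<open>F(x) = \<Prod>(1 - x\<^bsup>D/p\<^esup>)\<close> over the primes \<open>p\<close> dividing \<open>D\<close>. The factor of \<open>p\<close> vanishes at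
  \<open>\<zeta>\<^sup>c\<close> iff \<open>p\<close> divides \<open>c\<close>, so \<open>F(\<zeta>\<^sup>c) \<noteq> 0\<close> iff \<open>c\<close> is coprime to \<open>D\<close>,
  and the multiples \<open>c(k, l)\<close> with such \<open>c\<close> make up the class of \<open>(k, l)\<close>. Modulo \<open>x\<^sup>D - 1\<close>
  the coefficients stay in \<open>{-1,0,1}\<close>: multiplying by the factor of a new prime \<open>q\<close> subtracts a copy
  shifted by \<open>D/q\<close>, and the old support lies in the subgroup of \<open>\<int>/D\<close> whose order is the product of
  the earlier primes, which does not contain \<open>D/q\<close>; hence the two copies do not overlap
  (\<open>exists_ternary_function\<close>).
\<close>

section \<open>Characters and transforms of functions on the integer grid\<close>

definition unit_root :: "real \<Rightarrow> complex" where
  "unit_root x = cis (- (2 * pi * x))"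

lemma unit_root_add: "unit_root (x + y) = unit_root x * unit_root y"
  by (simp add: unit_root_def cis_mult algebra_simps)

lemma unit_root_eq_1_iff: "unit_root x = 1 \<longleftrightarrow> x \<in> \<int>"
proof -
  have "unit_root x = 1 \<longleftrightarrow> (\<exists>n::int. - (2 * pi * x) = of_int n * (2 * pi))"
    by (simp add: unit_root_def cis_eq_1_iff)
  also have "\<dots> \<longleftrightarrow> (\<exists>n::int. x = of_int (- n))"
  proof (intro ex_cong1)
    fix n :: int
    have "- (2 * pi * x) = of_int n * (2 * pi) \<longleftrightarrow> (2 * pi) * x = (2 * pi) * (of_int (- n))"
      by (auto simp: algebra_simps)
    then show "- (2 * pi * x) = of_int n * (2 * pi) \<longleftrightarrow> x = of_int (- n)"
      by (simp only: mult_cancel_left) simp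
  qed
  also have "\<dots> \<longleftrightarrow> x \<in> \<int>"
    by (metis Ints_cases Ints_of_int minus_minus)
  finally show ?thesis .
qed

definition grid_char :: "nat \<Rightarrow> nat \<Rightarrow> int \<Rightarrow> int \<Rightarrow> int \<Rightarrow> int \<Rightarrow> complex" where
  "grid_char N1 N2 k l m n =
     unit_root (of_int m * of_int k / of_nat N1 + of_int n * of_int l / of_nat N2)"

lemma grid_char_add:
  "grid_char N1 N2 k l (m + a) (n + b) = grid_char N1 N2 k l m n * grid_char N1 N2 k l a b"
  unfolding grid_char_def unit_root_add [symmetric]
  by (simp add: algebra_simps add_divide_distrib)

lemma grid_char_period:
  assumes "N1 > 0" "N2 > 0"
  shows "grid_char N1 N2 k l (m + int N1) n = grid_char N1 N2 k l m n"
    and "grid_char N1 N2 k l m (n + int N2) = grid_char N1 N2 k l m n"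
proof -
  have "grid_char N1 N2 k l (int N1) 0 = 1" "grid_char N1 N2 k l 0 (int N2) = 1"
    using assms by (simp_all add: grid_char_def unit_root_eq_1_iff)
  then show "grid_char N1 N2 k l (m + int N1) n = grid_char N1 N2 k l m n"
    "grid_char N1 N2 k l m (n + int N2) = grid_char N1 N2 k l m n"
    using grid_char_add [of N1 N2 k l m "int N1" n 0] grid_char_add [of N1 N2 k l m 0 n "int N2"]
    by simp_all
qed

definition grid_dft :: "nat \<Rightarrow> nat \<Rightarrow> (int \<Rightarrow> int \<Rightarrow> complex) \<Rightarrow> int \<Rightarrow> int \<Rightarrow> complex" where
  "grid_dft N1 N2 h k l = (\<Sum>m<N1. \<Sum>n<N2. h (int m) (int n) * grid_char N1 N2 k l (int m) (int n))"

lemma grid_dft_diff: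
  "grid_dft N1 N2 (\<lambda>m n. g m n - h m n) k l = grid_dft N1 N2 g k l - grid_dft N1 N2 h k l"
  by (simp add: grid_dft_def left_diff_distrib sum_subtractf)

lemma dft2_eq_sum:
  assumes "X \<in> carrier_mat N1 N2"
  shows "dft2 X (k, l) = (\<Sum>m<N1. \<Sum>n<N2. X $$ (m, n) * grid_char N1 N2 k l (int m) (int n))"
proof -
  have "exp (- 2 * complex_of_real pi * \<i> *
      (of_nat m * of_int k / of_nat N1 + of_nat n * of_int l / of_nat N2)) =
    grid_char N1 N2 k l (int m) (int n)" for m n
    unfolding grid_char_def unit_root_def cis_conv_exp
    by (intro arg_cong [where f = exp]) (simp add: mult_ac)
  with assms show ?thesis
    by (simp add: dft2_def)
qed

lemma dft2_add_grid_function: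
  fixes X Y :: "int mat" and z :: "int \<Rightarrow> int \<Rightarrow> int"
  assumes X: "X \<in> carrier_mat N1 N2" and Y: "Y \<in> carrier_mat N1 N2"
    and Z: "\<And>m n. m < N1 \<Longrightarrow> n < N2 \<Longrightarrow> Y $$ (m, n) = X $$ (m, n) + z (int m) (int n)"
  shows "dft2 (map_mat of_int Y) (k, l) =
    dft2 (map_mat of_int X) (k, l) + grid_dft N1 N2 (\<lambda>m n. of_int (z m n)) k l"
proof -
  have "dft2 (map_mat of_int Y) (k, l) =
    (\<Sum>m<N1. \<Sum>n<N2. of_int (Y $$ (m, n)) * grid_char N1 N2 k l (int m) (int n))"
    using Y by (subst dft2_eq_sum [of _ N1 N2]) (auto intro!: sum.cong)
  also have "\<dots> = (\<Sum>m<N1. \<Sum>n<N2. of_int (X $$ (m, n)) * grid_char N1 N2 k l (int m) (int n))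
      + grid_dft N1 N2 (\<lambda>m n. of_int (z m n)) k l"
    unfolding grid_dft_def sum.distrib [symmetric]
    by (auto intro!: sum.cong simp: Z algebra_simps)
  also have "(\<Sum>m<N1. \<Sum>n<N2. of_int (X $$ (m, n)) * grid_char N1 N2 k l (int m) (int n)) =
    dft2 (map_mat of_int X) (k, l)"
    using X by (subst dft2_eq_sum [of _ N1 N2]) (auto intro!: sum.cong)
  finally show ?thesis .
qed

lemma sum_periodic_shift:
  fixes H :: "int \<Rightarrow> 'a :: ab_group_add"
  assumes per: "\<And>x. H (x + int N) = H x"
  shows "(\<Sum>m<N. H (int m + a)) = (\<Sum>m<N. H (int m))"
proof -
  have step: "(\<Sum>m<N. H (int m + (b + 1))) = (\<Sum>m<N. H (int m + b))" for b
  proof -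
    \<comment> \<open>Split the sum over one period and one more term at either end.\<close>
    have "(\<Sum>m<Suc N. H (int m + b)) = H b + (\<Sum>m<N. H (int m + (b + 1)))"
      by (subst sum.lessThan_Suc_shift) (simp add: algebra_simps)
    moreover have "(\<Sum>m<Suc N. H (int m + b)) = (\<Sum>m<N. H (int m + b)) + H b"
      using per [of b] by (simp add: add.commute)
    ultimately show ?thesis
      by (simp add: add.commute)
  qed
  show ?thesis
  proof (induction a rule: int_induct [where k = 0])
    case base
    then show ?case by simp
  next
    case (step1 i)
    then show ?case using step [of i] by simp
  next
    case (step2 i)
    then show ?case using step [of "i - 1"] by simp
  qed
qed

lemma grid_dft_shift:
  assumes "N1 > 0" "N2 > 0"
    and h1: "\<And>m n. h (m + int N1) n = h m n" and h2: "\<And>m n. h m (n + int N2) = h m n"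
  shows "grid_dft N1 N2 (\<lambda>m n. h (m - a) (n - b)) k l =
    grid_char N1 N2 k l a b * grid_dft N1 N2 h k l"
proof -
  define H where "H m n = h (m - a) (n - b) * grid_char N1 N2 k l m n" for m n
  have H1: "H (m + int N1) n = H m n" and H2: "H m (n + int N2) = H m n" for m n
    using h1 [of "m - a" "n - b"] h2 [of "m - a" "n - b"] grid_char_period [OF assms(1,2)]
    by (simp_all add: H_def algebra_simps)
  have "grid_dft N1 N2 (\<lambda>m n. h (m - a) (n - b)) k l = (\<Sum>m<N1. \<Sum>n<N2. H (int m) (int n))"
    by (simp add: grid_dft_def H_def)
  also have "\<dots> = (\<Sum>m<N1. \<Sum>n<N2. H (int m) (int n + b))"
    by (intro sum.cong refl sum_periodic_shift [symmetric] H2)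
  also have "\<dots> = (\<Sum>m<N1. \<Sum>n<N2. H (int m + a) (int n + b))"
    by (intro sum_periodic_shift [where H = "\<lambda>m. \<Sum>n<N2. H m (int n + b)", symmetric])
      (simp add: H1)
  also have "\<dots> = grid_char N1 N2 k l a b * grid_dft N1 N2 h k l"
    by (simp add: grid_dft_def H_def grid_char_add sum_distrib_left mult_ac)
  finally show ?thesis .
qed

section \<open>The order of a frequency\<close>

lemma dvd_mult_iff_div_gcd_dvd:
  fixes N x k :: int
  assumes "N > 0"
  shows "N dvd x * k \<longleftrightarrow> N div gcd k N dvd x"
proof -
  define g where "g = gcd k N"
  have "g \<noteq> 0" using assms by (simp add: g_def)
  obtain k' N' where k: "k = k' * g" and N: "N = N' * g" and cop: "coprime k' N'"
    using gcd_coprime_exists [of k N] \<open>g \<noteq> 0\<close> unfolding g_def by blast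
  have "N dvd x * k \<longleftrightarrow> N' * g dvd (x * k') * g"
    by (simp add: k N mult.assoc)
  also have "\<dots> \<longleftrightarrow> N' dvd x * k'"
    using \<open>g \<noteq> 0\<close> by simp
  also have "\<dots> \<longleftrightarrow> N' dvd x"
    using cop by (simp add: coprime_commute coprime_dvd_mult_left_iff)
  also have "N' = N div gcd k N"
    using \<open>g \<noteq> 0\<close> N unfolding g_def by (metis nonzero_mult_div_cancel_right)
  finally show ?thesis .
qed

lemma freq_order_dvd_iff:
  assumes "N1 > 0" "N2 > 0"
  shows "freq_order N1 N2 (k, l) dvd x \<longleftrightarrow> int N1 dvd x * k \<and> int N2 dvd x * l"
  using assms by (simp add: freq_order_def dvd_mult_iff_div_gcd_dvd)

lemma freq_order_pos:
  assumes "N1 > 0" "N2 > 0"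
  shows "freq_order N1 N2 (k, l) > 0"
proof -
  have "int N div gcd x (int N) \<noteq> 0" if "N > 0" for N x
    using that by (simp add: dvd_div_eq_0_iff)
  then have "freq_order N1 N2 (k, l) \<noteq> 0"
    using assms by (simp add: freq_order_def)
  moreover have "freq_order N1 N2 (k, l) \<ge> 0"
    by (simp add: freq_order_def)
  ultimately show ?thesis by linarith
qed

text \<open>Invertible multipliers preserve the order, so the asymmetric definition, in which the multiplier
  is coprime to the order of the first frequency, gives a symmetric relation. A zero multiplier
  is coprime to the order only if the order is 1, and can then be replaced by 1.\<close>

lemma freq_equiv_commute_iff:
  assumes N: "N1 > 0" "N2 > 0"
  shows "freq_equiv N1 N2 (k', l') (k, l) \<longleftrightarrow>
    (\<exists>c. coprime c (freq_order N1 N2 (k, l)) \<and> [k' = c * k] (mod int N1) \<and> [l' = c * l] (mod int N2))"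
proof -
  have invert: "\<exists>d. d \<noteq> 0 \<and> coprime d (freq_order N1 N2 (k', l')) \<and>
      [k = d * k'] (mod int N1) \<and> [l = d * l'] (mod int N2)"
    if c: "coprime c (freq_order N1 N2 (k, l))" "[k' = c * k] (mod int N1)" "[l' = c * l] (mod int N2)"
    for c k l k' l'
  proof -
    let ?D = "freq_order N1 N2 (k, l)" and ?D' = "freq_order N1 N2 (k', l')"
    obtain d0 where d0: "[c * d0 = 1] (mod ?D)"
      using cong_solve_coprime_int c(1) by blast
    \<comment> \<open>Only for order 1 can \<open>d0\<close> be zero; the order itself is then an inverse.\<close>
    define d where "d = (if d0 = 0 then ?D else d0)"
    have d: "[c * d = 1] (mod ?D)" "d \<noteq> 0"
      using d0 freq_order_pos [OF N, of k l] by (auto simp: d_def cong_def)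
    have "?D dvd c * d - 1"
      using d by (simp add: cong_iff_dvd_diff)
    then have "int N1 dvd (c * d - 1) * k" "int N2 dvd (c * d - 1) * l"
      by (simp_all add: freq_order_dvd_iff N)
    then have "[d * (c * k) = k] (mod int N1)" "[d * (c * l) = l] (mod int N2)"
      by (simp_all add: cong_iff_dvd_diff algebra_simps)
    then have inv: "[k = d * k'] (mod int N1)" "[l = d * l'] (mod int N2)"
      using c(2,3) by (meson cong_scalar_left cong_sym cong_trans)+
    have "int N1 dvd x * k \<longleftrightarrow> int N1 dvd x * k'" for x
      using cong_dvd_iff [OF cong_scalar_left [OF c(2), of x]]
        cong_dvd_iff [OF cong_scalar_left [OF inv(1), of x]]
      by (metis dvd_mult mult.left_commute)
    moreover have "int N2 dvd x * l \<longleftrightarrow> int N2 dvd x * l'" for x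
      using cong_dvd_iff [OF cong_scalar_left [OF c(3), of x]]
        cong_dvd_iff [OF cong_scalar_left [OF inv(2), of x]]
      by (metis dvd_mult mult.left_commute)
    ultimately have "?D dvd x \<longleftrightarrow> ?D' dvd x" for x
      by (simp add: freq_order_dvd_iff N)
    then have "?D' dvd ?D" using dvd_refl by blast
    moreover have "coprime d ?D"
      using d(1) by (auto simp: coprime_iff_invertible_int mult.commute)
    ultimately have "coprime d ?D'"
      using coprime_divisors dvd_refl by blast
    with d(2) inv show ?thesis by blast
  qed
  show ?thesis
  proof
    assume "freq_equiv N1 N2 (k', l') (k, l)"
    then show "\<exists>c. coprime c (freq_order N1 N2 (k, l)) \<and>
        [k' = c * k] (mod int N1) \<and> [l' = c * l] (mod int N2)"
      using invert by (fastforce simp: freq_equiv_def)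
  next
    assume "\<exists>c. coprime c (freq_order N1 N2 (k, l)) \<and>
        [k' = c * k] (mod int N1) \<and> [l' = c * l] (mod int N2)"
    then show "freq_equiv N1 N2 (k', l') (k, l)"
      using invert by (fastforce simp: freq_equiv_def)
  qed
qed

section \<open>Functions constant on the fibres of the phase\<close>

text \<open>The integers \<open>u\<close> and \<open>v\<close> are the numerators of \<open>k/N1\<close> and \<open>l/N2\<close> over the common denominator
  \<open>D\<close>, and \<open>(a, b)\<close> is a grid point of phase 1 modulo \<open>D\<close>.\<close>

locale grid_phase =
  fixes N1 N2 :: nat and k l D u v a b :: int
  assumes N: "N1 > 0" "N2 > 0" and D: "D > 0"
    and u: "D * k = u * int N1" and v: "D * l = v * int N2"
    and ab: "[a * u + b * v = 1] (mod D)"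
begin

definition phase :: "int \<Rightarrow> int \<Rightarrow> int" where
  "phase m n = m * u + n * v"

lemma grid_char_multiple:
  assumes "[k' = c * k] (mod int N1)" "[l' = c * l] (mod int N2)"
  shows "grid_char N1 N2 k' l' m n = unit_root (of_int (c * phase m n) / of_int D)"
proof -
  obtain s t where s: "k' = c * k + int N1 * s" and t: "l' = c * l + int N2 * t"
    using assms by (metis cong_iff_lin cong_sym)
  have uk: "real_of_int k / real N1 = real_of_int u / real_of_int D"
    using N D arg_cong [OF u, of real_of_int] by (simp add: field_simps)
  have vl: "real_of_int l / real N2 = real_of_int v / real_of_int D"
    using N D arg_cong [OF v, of real_of_int] by (simp add: field_simps)
  have "real_of_int m * real_of_int k' / real N1 + real_of_int n * real_of_int l' / real N2
    = real_of_int (m * c) * (real_of_int k / real N1)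
      + real_of_int (n * c) * (real_of_int l / real N2) + real_of_int (m * s + n * t)"
    using N by (simp add: s t field_simps)
  also have "\<dots> = of_int (c * phase m n) / of_int D + real_of_int (m * s + n * t)"
    unfolding uk vl phase_def by (simp add: algebra_simps add_divide_distrib)
  finally show ?thesis
    unfolding grid_char_def by (simp only: unit_root_add) (simp add: unit_root_eq_1_iff)
qed

text \<open>A character trivial on the kernel of \<open>phase\<close> factors through \<open>\<int>/D\<close>, hence is determined by its
  value at \<open>(a, b)\<close>, a \<open>D\<close>-th root of unity. The exponent of that root is the multiplier; comparing
  the values at \<open>(1, 0)\<close> and \<open>(0, 1)\<close>, which differ from multiples of \<open>(a, b)\<close> by kernel elements,
  identifies the frequency.\<close>

lemma exists_multiplier:
  assumes triv: "\<And>m n. D dvd phase m n \<Longrightarrow> grid_char N1 N2 k' l' m n = 1"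
  shows "\<exists>c. [k' = c * k] (mod int N1) \<and> [l' = c * l] (mod int N2)"
proof -
  define x y where "x = real_of_int k' / real N1" and "y = real_of_int l' / real N2"
  have int: "real_of_int m * x + real_of_int n * y \<in> \<int>" if "D dvd phase m n" for m n
    using triv [OF that] by (simp add: grid_char_def unit_root_eq_1_iff x_def y_def)
  have ab': "D dvd 1 - (a * u + b * v)"
    using ab by (metis cong_iff_dvd_diff cong_sym)
  obtain c :: int where c: "real_of_int (D * a) * x + real_of_int (D * b) * y = of_int c"
    using int [of "D * a" "D * b"] by (auto simp: phase_def mult.assoc elim: Ints_cases)
  have "phase (1 - u * a) (- (u * b)) = u * (1 - (a * u + b * v))"
    by (simp add: phase_def algebra_simps)
  then have "D dvd phase (1 - u * a) (- (u * b))"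
    using ab' by simp
  then obtain s :: int where s: "real_of_int (1 - u * a) * x + real_of_int (- (u * b)) * y = of_int s"
    using int by (meson Ints_cases)
  have "phase (- (v * a)) (1 - v * b) = v * (1 - (a * u + b * v))"
    by (simp add: phase_def algebra_simps)
  then have "D dvd phase (- (v * a)) (1 - v * b)"
    using ab' by simp
  then obtain t :: int where t: "real_of_int (- (v * a)) * x + real_of_int (1 - v * b) * y = of_int t"
    using int by (meson Ints_cases)
  have "real_of_int D * x = of_int D * of_int s + of_int u * of_int c"
    unfolding s [symmetric] c [symmetric] by (simp add: algebra_simps)
  then have "real_of_int (D * k') = real_of_int (D * s * int N1 + u * int N1 * c)"
    using N by (simp add: x_def field_simps)
  then have "D * k' = D * s * int N1 + u * int N1 * c"
    by (simp only: of_int_eq_iff)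
  also have "\<dots> = D * (c * k + int N1 * s)"
    by (simp add: u [symmetric] algebra_simps)
  finally have k': "k' = c * k + int N1 * s"
    using D by simp
  have "real_of_int D * y = of_int D * of_int t + of_int v * of_int c"
    unfolding t [symmetric] c [symmetric] by (simp add: algebra_simps)
  then have "real_of_int (D * l') = real_of_int (D * t * int N2 + v * int N2 * c)"
    using N by (simp add: y_def field_simps)
  then have "D * l' = D * t * int N2 + v * int N2 * c"
    by (simp only: of_int_eq_iff)
  also have "\<dots> = D * (c * l + int N2 * t)"
    by (simp add: v [symmetric] algebra_simps)
  finally have l': "l' = c * l + int N2 * t"
    using D by simp
  have "[k' = c * k] (mod int N1)" "[l' = c * l] (mod int N2)"
    by (simp_all add: k' l' cong_iff_dvd_diff)
  then show ?thesis by blast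
qed

definition kernel_indicator :: "int \<Rightarrow> int" where
  "kernel_indicator j = (if D dvd j then 1 else 0)"

abbreviation phase_dft :: "(int \<Rightarrow> int) \<Rightarrow> int \<Rightarrow> int \<Rightarrow> complex" where
  "phase_dft f \<equiv> grid_dft N1 N2 (\<lambda>m n. of_int (f (phase m n)))"

lemma periodic_mult:
  fixes f :: "int \<Rightarrow> int"
  assumes f: "\<And>j. f (j + D) = f j"
  shows "f (j + D * i) = f j"
proof (induction i rule: int_induct [where k = 0])
  case base
  then show ?case by simp
next
  case (step1 i)
  then show ?case using f [of "j + D * i"] by (simp add: algebra_simps)
next
  case (step2 i)
  then show ?case using f [of "j + D * (i - 1)"] by (simp add: algebra_simps)
qed

text \<open>The point \<open>r (a, b)\<close> has phase \<open>r\<close> modulo \<open>D\<close>, so shifting \<open>f\<close> by \<open>r\<close> amounts to shifting the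
  grid by that point.\<close>

lemma phase_dft_shift:
  assumes f: "\<And>j. f (j + D) = f j"
  shows "phase_dft (\<lambda>j. f (j - r)) k' l' = grid_char N1 N2 k' l' (r * a) (r * b) * phase_dft f k' l'"
proof -
  obtain t where t: "a * u + b * v = 1 + D * t"
    using ab by (metis cong_iff_lin cong_sym)
  have "phase (m - r * a) (n - r * b) = phase m n - r * (a * u + b * v)" for m n
    by (simp add: phase_def algebra_simps)
  then have "phase (m - r * a) (n - r * b) = phase m n - r + D * (- r * t)" for m n
    by (simp add: t algebra_simps)
  then have eq: "f (phase m n - r) = f (phase (m - r * a) (n - r * b))" for m n
    using periodic_mult [of f, OF f] by metis
  have "phase (m + int N1) n = phase m n + D * k" "phase m (n + int N2) = phase m n + D * l" for m n
    by (simp_all add: phase_def u v algebra_simps)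
  then have "f (phase (m + int N1) n) = f (phase m n)" "f (phase m (n + int N2)) = f (phase m n)" for m n
    using periodic_mult [of f, OF f] by simp_all
  then show ?thesis
    unfolding eq by (intro grid_dft_shift [where h = "\<lambda>m n. of_int (f (phase m n))"] N) simp_all
qed

text \<open>The indicator of a subgroup is transformed to a multiple of the indicator of its annihilator:
  translation by a kernel element on which the character differs from 1 leaves the sum unchanged but
  multiplies it by that value.\<close>

lemma kernel_dft_nonzero_iff:
  "phase_dft kernel_indicator k' l' \<noteq> 0 \<longleftrightarrow>
    (\<exists>c. [k' = c * k] (mod int N1) \<and> [l' = c * l] (mod int N2))"
proof
  assume nz: "phase_dft kernel_indicator k' l' \<noteq> 0"
  show "\<exists>c. [k' = c * k] (mod int N1) \<and> [l' = c * l] (mod int N2)"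
  proof (rule exists_multiplier)
    fix m0 n0 assume dvd: "D dvd phase m0 n0"
    let ?h = "\<lambda>m n. of_int (kernel_indicator (phase m n)) :: complex"
    have inv: "kernel_indicator (phase (m - m0) (n - n0)) = kernel_indicator (phase m n)" for m n
    proof -
      have "phase m n = phase (m - m0) (n - n0) + phase m0 n0"
        by (simp add: phase_def algebra_simps)
      then show ?thesis
        using dvd by (simp add: kernel_indicator_def dvd_add_left_iff)
    qed
    have "phase (m + int N1) n = phase m n + D * k" "phase m (n + int N2) = phase m n + D * l" for m n
      by (simp_all add: phase_def u v algebra_simps)
    then have "grid_dft N1 N2 (\<lambda>m n. ?h (m - m0) (n - n0)) k' l' =
        grid_char N1 N2 k' l' m0 n0 * grid_dft N1 N2 ?h k' l'"
      by (intro grid_dft_shift N) (simp_all add: kernel_indicator_def dvd_add_left_iff)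
    then show "grid_char N1 N2 k' l' m0 n0 = 1"
      using nz by (simp add: inv)
  qed
next
  assume "\<exists>c. [k' = c * k] (mod int N1) \<and> [l' = c * l] (mod int N2)"
  then obtain c where c: "[k' = c * k] (mod int N1)" "[l' = c * l] (mod int N2)" by blast
  have char: "grid_char N1 N2 k' l' m n = 1" if dvd: "D dvd phase m n" for m n
  proof -
    obtain i where "phase m n = D * i" using dvd by blast
    then show ?thesis
      using D by (simp add: grid_char_multiple [OF c] unit_root_eq_1_iff)
  qed
  have "of_int (kernel_indicator (phase m n)) * grid_char N1 N2 k' l' m n =
      of_int (kernel_indicator (phase m n))" for m n
    using char [of m n] by (simp add: kernel_indicator_def)
  then have eq: "phase_dft kernel_indicator k' l' =
      of_int (\<Sum>m<N1. \<Sum>n<N2. kernel_indicator (phase (int m) (int n)))"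
    by (simp only: grid_dft_def of_int_sum)
  \<comment> \<open>The origin always lies in the kernel.\<close>
  have "0 < (\<Sum>m<N1. \<Sum>n<N2. kernel_indicator (phase (int m) (int n)))"
    using N by (intro sum_pos2 [of _ 0] sum_nonneg) (auto simp: kernel_indicator_def phase_def)
  then show "phase_dft kernel_indicator k' l' \<noteq> 0"
    unfolding eq of_int_eq_0_iff by linarith
qed

text \<open>The third property, that \<open>f\<close> lives on the subgroup of order \<open>\<Prod>P\<close>, is what keeps the values in
  \<open>{-1,0,1}\<close> when a further prime is added.\<close>

lemma exists_ternary_function:
  assumes "finite P" "\<And>p. p \<in> P \<Longrightarrow> prime p \<and> p dvd D"
  shows "\<exists>f. (\<forall>j. f (j + D) = f j) \<and> (\<forall>j. f j \<in> {-1, 0, 1}) \<and> (\<forall>j. f j \<noteq> 0 \<longrightarrow> D dvd j * \<Prod>P) \<and>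
    (\<forall>k' l'. phase_dft f k' l' = phase_dft kernel_indicator k' l' *
       (\<Prod>p\<in>P. 1 - grid_char N1 N2 k' l' (D div p * a) (D div p * b)))"
  using assms
proof (induction P rule: finite_induct)
  case empty
  then show ?case
    by (intro exI [of _ kernel_indicator]) (auto simp: kernel_indicator_def)
next
  case (insert q P)
  then obtain f where per: "\<And>j. f (j + D) = f j" and val: "\<And>j. f j \<in> {-1, 0, 1}"
    and supp: "\<And>j. f j \<noteq> 0 \<Longrightarrow> D dvd j * \<Prod>P"
    and dft: "\<And>k' l'. phase_dft f k' l' = phase_dft kernel_indicator k' l' *
       (\<Prod>p\<in>P. 1 - grid_char N1 N2 k' l' (D div p * a) (D div p * b))"
    by blast
  have q: "prime q" "q dvd D" using insert.prems by auto
  define r where "r = D div q"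
  have r: "D = r * q" "r \<noteq> 0" using q D by (auto simp: r_def)
  have qP: "\<not> q dvd \<Prod>P"
  proof
    assume "q dvd \<Prod>P"
    then obtain p where "p \<in> P" "q dvd p"
      using prime_dvd_prod_iff [of P q id] insert.hyps q by auto
    then show False
      using insert primes_dvd_imp_eq q(1) by blast
  qed
  have disj: "f j = 0 \<or> f (j - r) = 0" for j
  proof (rule ccontr)
    assume "\<not> ?thesis"
    then have "D dvd j * \<Prod>P - (j - r) * \<Prod>P"
      using supp [of j] supp [of "j - r"] by (intro dvd_diff) auto
    then have "r * q dvd r * \<Prod>P"
      by (simp add: r(1) algebra_simps)
    with r(2) qP show False by simp
  qed
  let ?g = "\<lambda>j. f j - f (j - r)"
  show ?case
  proof (intro exI [of _ ?g] conjI allI impI)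
    fix j
    show "?g (j + D) = ?g j"
      using per [of j] per [of "j - r"] by (simp add: algebra_simps)
    show "?g j \<in> {-1, 0, 1}"
      using disj [of j] val [of j] val [of "j - r"] by auto
    assume "?g j \<noteq> 0"
    then have "D dvd j * \<Prod>P \<or> D dvd (j - r) * \<Prod>P"
      using supp [of j] supp [of "j - r"] by (cases "f j = 0") auto
    moreover have "D dvd j * \<Prod>P * q" if "D dvd (j - r) * \<Prod>P"
    proof -
      have "D dvd (j - r) * \<Prod>P * q + D * \<Prod>P"
        using dvd_mult2 [OF that, of q] by (intro dvd_add dvd_triv_left)
      also have "(j - r) * \<Prod>P * q + D * \<Prod>P = j * \<Prod>P * q"
        by (simp add: r(1) algebra_simps)
      finally show ?thesis .
    qed
    ultimately have "D dvd j * \<Prod>P * q" by auto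
    then show "D dvd j * \<Prod>(insert q P)"
      using insert.hyps by (simp add: mult_ac)
  next
    fix k' l'
    have "phase_dft ?g k' l' = phase_dft f k' l' - phase_dft (\<lambda>j. f (j - r)) k' l'"
      by (simp add: grid_dft_diff)
    also have "\<dots> = (1 - grid_char N1 N2 k' l' (r * a) (r * b)) * phase_dft f k' l'"
      by (simp add: phase_dft_shift [of f, OF per] algebra_simps)
    finally show "phase_dft ?g k' l' = phase_dft kernel_indicator k' l' *
       (\<Prod>p\<in>insert q P. 1 - grid_char N1 N2 k' l' (D div p * a) (D div p * b))"
      using insert.hyps by (simp add: dft r_def mult_ac)
  qed
qed

lemma exists_ternary_with_dft_support:
  "\<exists>z :: int \<Rightarrow> int \<Rightarrow> int. (\<forall>m n. z m n \<in> {-1, 0, 1}) \<and>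
    (\<forall>k' l'. grid_dft N1 N2 (\<lambda>m n. of_int (z m n)) k' l' \<noteq> 0 \<longleftrightarrow>
      (\<exists>c. coprime c D \<and> [k' = c * k] (mod int N1) \<and> [l' = c * l] (mod int N2)))"
proof -
  define P where "P = prime_factors D"
  have P: "finite P" "p \<in> P \<longleftrightarrow> prime p \<and> p dvd D" for p
    using D by (auto simp: P_def in_prime_factors_iff)
  obtain f where val: "\<And>j. f j \<in> {-1, 0, 1}"
    and dft: "\<And>k' l'. phase_dft f k' l' = phase_dft kernel_indicator k' l' *
       (\<Prod>p\<in>P. 1 - grid_char N1 N2 k' l' (D div p * a) (D div p * b))"
    using exists_ternary_function [of P] P by meson
  have char: "grid_char N1 N2 k' l' (D div p * a) (D div p * b) = 1 \<longleftrightarrow> p dvd c"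
    if p: "p \<in> P" and c: "[k' = c * k] (mod int N1)" "[l' = c * l] (mod int N2)" for p c k' l'
  proof -
    have pp: "prime p" "p dvd D" using p P(2) by auto
    then obtain r where r: "D = p * r" by blast
    have nz: "p \<noteq> 0" "r \<noteq> 0" using r D by auto
    have "[a * u + b * v = 1] (mod p)"
      using ab pp(2) by (rule cong_dvd_modulus)
    then have cop: "coprime p (a * u + b * v)"
      by (metis coprime_1_right cong_imp_coprime cong_sym coprime_commute)
    have "D div p = r" using nz by (simp add: r)
    moreover have "phase (r * a) (r * b) = r * (a * u + b * v)"
      by (simp add: phase_def algebra_simps)
    ultimately have "grid_char N1 N2 k' l' (D div p * a) (D div p * b)
        = unit_root (of_int (c * (r * (a * u + b * v))) / of_int (p * r))"
      by (simp only: grid_char_multiple [OF c] flip: r)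
    also have "\<dots> = unit_root (of_int (c * (a * u + b * v)) / of_int p)"
      using nz by simp
    also have "\<dots> = 1 \<longleftrightarrow> p dvd c * (a * u + b * v)"
      unfolding unit_root_eq_1_iff using nz of_int_div_of_int_in_Ints_iff by blast
    also have "\<dots> \<longleftrightarrow> p dvd c"
      using cop by (simp add: coprime_dvd_mult_left_iff)
    finally show ?thesis .
  qed
  have cop: "coprime c D \<longleftrightarrow> (\<forall>p\<in>P. \<not> p dvd c)" for c
  proof
    assume "coprime c D"
    then show "\<forall>p\<in>P. \<not> p dvd c"
      using P(2) coprime_common_divisor not_prime_unit by blast
  next
    assume *: "\<forall>p\<in>P. \<not> p dvd c"
    show "coprime c D"
    proof (rule ccontr)
      assume "\<not> coprime c D"
      then have "gcd c D \<noteq> 0" "\<not> is_unit (gcd c D)"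
        using D by (auto simp: coprime_iff_gcd_eq_1)
      then obtain p where "p dvd gcd c D" "prime p"
        using prime_divisor_exists by blast
      with * P(2) show False by auto
    qed
  qed
  have "phase_dft f k' l' \<noteq> 0 \<longleftrightarrow>
      (\<exists>c. coprime c D \<and> [k' = c * k] (mod int N1) \<and> [l' = c * l] (mod int N2))" for k' l'
  proof -
    have "(\<Prod>p\<in>P. 1 - grid_char N1 N2 k' l' (D div p * a) (D div p * b)) \<noteq> 0 \<longleftrightarrow> coprime c D"
      if "[k' = c * k] (mod int N1)" "[l' = c * l] (mod int N2)" for c
      using char [OF _ that] P(1) by (auto simp: cop)
    then show ?thesis
      unfolding dft mult_eq_0_iff de_Morgan_disj kernel_dft_nonzero_iff by blast
  qed
  with val show ?thesis
    by (intro exI [of _ "\<lambda>m n. f (phase m n)"]) simp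
qed

end

text \<open>Every frequency gives such a phase: a non-trivial common factor of \<open>u\<close>, \<open>v\<close> and \<open>D\<close>
  would yield a proper divisor of the order that still annihilates \<open>(k, l)\<close>.\<close>

lemma grid_phase_exists:
  assumes N: "N1 > 0" "N2 > 0"
  shows "\<exists>u v a b. grid_phase N1 N2 k l (freq_order N1 N2 (k, l)) u v a b"
proof -
  define D where "D = freq_order N1 N2 (k, l)"
  have D: "D > 0" using freq_order_pos [OF N] by (simp add: D_def)
  have "int N1 dvd D * k" "int N2 dvd D * l"
    using freq_order_dvd_iff [OF N, of k l D] by (simp_all add: D_def)
  then obtain u v where u: "D * k = u * int N1" and v: "D * l = v * int N2"
    by (metis dvdE mult.commute)
  define g where "g = gcd (gcd u v) D"
  have g: "g dvd u" "g dvd v" "g dvd D" "g > 0"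
    using D by (auto simp: g_def dvd_trans [OF gcd_dvd1])
  obtain u' v' D' where eqs: "u = g * u'" "v = g * v'" "D = g * D'"
    using g by (elim dvdE)
  have "D' * k = u' * int N1" "D' * l = v' * int N2"
    using u v g(4) by (simp_all add: eqs mult.assoc)
  then have "D dvd D'"
    unfolding D_def freq_order_dvd_iff [OF N] by simp
  then have "g * D' dvd 1 * D'" by (simp add: eqs)
  then have "g dvd 1" using D eqs(3) by (subst (asm) dvd_mult_cancel_right) auto
  then have g1: "g = 1" using g(4) by simp
  obtain a0 b0 where ab0: "a0 * u + b0 * v = gcd u v"
    using bezout_int by blast
  obtain s t where "s * gcd u v + t * D = 1"
    using bezout_int [of "gcd u v" D] g1 by (auto simp: g_def)
  then have "(s * a0) * u + (s * b0) * v = 1 + D * (- t)"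
    by (simp add: ab0 [symmetric] algebra_simps)
  then have "[(s * a0) * u + (s * b0) * v = 1] (mod D)"
    by (simp add: cong_iff_dvd_diff)
  then have "grid_phase N1 N2 k l D u v (s * a0) (s * b0)"
    using N D u v by unfold_locales
  then show ?thesis
    unfolding D_def by blast
qed

section \<open>Perturbing a single class of frequencies\<close>

theorem theorem3p8:
  fixes N1 N2 :: nat and k l :: int
  assumes "N1 > 0" and "N2 > 0"
    and "0 \<le> k" and "k < int N1" and "0 \<le> l" and "l < int N2"
  shows "(\<forall>X :: int mat. X \<in> carrier_mat N1 N2 \<longrightarrow>
           (\<exists>Y :: int mat. Y \<in> carrier_mat N1 N2 \<and>
             (\<forall>k' l' :: int. dft2 (map_mat of_int X) (k', l') \<noteq> dft2 (map_mat of_int Y) (k', l')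
                \<longleftrightarrow> freq_equiv N1 N2 (k', l') (k, l)))) \<and>
         (\<exists>X1 X2 :: int mat. X1 \<in> carrier_mat N1 N2 \<and> X2 \<in> carrier_mat N1 N2 \<and>
           elements_mat X1 \<subseteq> {0, 1} \<and> elements_mat X2 \<subseteq> {0, 1} \<and>
           (\<forall>k' l' :: int. dft2 (map_mat of_int X1) (k', l') \<noteq> dft2 (map_mat of_int X2) (k', l')
              \<longleftrightarrow> freq_equiv N1 N2 (k', l') (k, l)))"
proof -
  obtain u v a b where "grid_phase N1 N2 k l (freq_order N1 N2 (k, l)) u v a b"
    using grid_phase_exists assms(1,2) by blast
  then obtain z :: "int \<Rightarrow> int \<Rightarrow> int" where z: "\<And>m n. z m n \<in> {-1, 0, 1}"
    and supp: "\<And>k' l'. grid_dft N1 N2 (\<lambda>m n. of_int (z m n)) k' l' \<noteq> 0 \<longleftrightarrow>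
      freq_equiv N1 N2 (k', l') (k, l)"
    using grid_phase.exists_ternary_with_dft_support
    unfolding freq_equiv_commute_iff [OF assms(1,2)] by blast
  have diff: "dft2 (map_mat of_int X) (k', l') \<noteq> dft2 (map_mat of_int Y) (k', l')
      \<longleftrightarrow> freq_equiv N1 N2 (k', l') (k, l)"
    if "X \<in> carrier_mat N1 N2" "Y \<in> carrier_mat N1 N2"
      "\<And>m n. m < N1 \<Longrightarrow> n < N2 \<Longrightarrow> Y $$ (m, n) = X $$ (m, n) + z (int m) (int n)"
    for X Y :: "int mat" and k' l'
    using dft2_add_grid_function [OF that, of k' l'] supp [of k' l'] by auto
  show ?thesis
  proof (intro conjI allI impI)
    fix X :: "int mat" assume X: "X \<in> carrier_mat N1 N2"
    let ?Y = "mat N1 N2 (\<lambda>(m, n). X $$ (m, n) + z (int m) (int n))"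
    have "\<forall>k' l'. dft2 (map_mat of_int X) (k', l') \<noteq> dft2 (map_mat of_int ?Y) (k', l')
        \<longleftrightarrow> freq_equiv N1 N2 (k', l') (k, l)"
      by (intro allI diff X) simp_all
    then show "\<exists>Y :: int mat. Y \<in> carrier_mat N1 N2 \<and>
        (\<forall>k' l'. dft2 (map_mat of_int X) (k', l') \<noteq> dft2 (map_mat of_int Y) (k', l')
          \<longleftrightarrow> freq_equiv N1 N2 (k', l') (k, l))"
      by (intro exI [of _ ?Y]) simp
  next
    let ?X1 = "mat N1 N2 (\<lambda>(m, n). max 0 (- z (int m) (int n)))"
    let ?X2 = "mat N1 N2 (\<lambda>(m, n). max 0 (z (int m) (int n)))"
    have max01: "max 0 (z m n) \<in> {0, 1}" "max 0 (- z m n) \<in> {0, 1}" for m n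
      using z [of m n] by auto
    have "\<forall>k' l'. dft2 (map_mat of_int ?X1) (k', l') \<noteq> dft2 (map_mat of_int ?X2) (k', l')
        \<longleftrightarrow> freq_equiv N1 N2 (k', l') (k, l)"
      by (intro allI diff) (simp_all add: max_def)
    moreover have "elements_mat ?X1 \<subseteq> {0, 1}" "elements_mat ?X2 \<subseteq> {0, 1}"
      using max01 by (fastforce dest: elements_matD)+
    ultimately show "\<exists>X1 X2 :: int mat. X1 \<in> carrier_mat N1 N2 \<and> X2 \<in> carrier_mat N1 N2 \<and>
        elements_mat X1 \<subseteq> {0, 1} \<and> elements_mat X2 \<subseteq> {0, 1} \<and>
        (\<forall>k' l'. dft2 (map_mat of_int X1) (k', l') \<noteq> dft2 (map_mat of_int X2) (k', l')
          \<longleftrightarrow> freq_equiv N1 N2 (k', l') (k, l))"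
      by (intro exI [of _ ?X1] exI [of _ ?X2]) simp
  qed
qed

end
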